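(* Let $G$ be a Lie group acting smoothly on $\mathbb{R}^n$, let $f:\mathbb{R}^n\to\mathbb{R}\cup\{\infty\}$ be invariant under this action (i.e. $f(gx)=f(x)$ for all $g\in G$, $x\in\mathbb{R}^n$), and let $\overline{x}\in\mathrm{dom} f$. If the action is typical at $\overline{x}$, then $$P_{T_{\overline{x}}G\overline{x}}\,\partial f(\overline{x})\subseteq\{0\}\quad\text{and}\quad P_{T_{\overline{x}}G\overline{x}}\,\partial^\infty f(\overline{x})=\{0\}.$$
   Context: Smooth means $C^k$ for some fixed $k\in\{1,2,\dots,\infty\}$. $\mathrm{dom} f=\{x: f(x)<\infty\}$; $\langle\cdot,\cdot\rangle$ and $|\cdot|$ are the Euclidean inner product and norm; neighborhoods are open. For a set $S$ and a subspace $V$ of $\mathbb{R}^n$, $P_V S=\{P_V s: s\in S\}$ with $P_V$ the orthogonal projection onto $V$. Action: $\theta:G\times\mathbb{R}^n\to\mathbb{R}^n$, $gx=\theta(g,x)$. The orbit $Gx=\{gx:g\in G\}$ is an immersed submanifold; with $\theta^{(x)}(g)=gx$, its tangent space at $x$ is $T_xGx=\mathrm{Im}\,d(\theta^{(x)})_e\subseteq\mathbb{R}^n$. The isotropy group is $G_x=\{g: gx=x\}$; the type of the orbit of $x$ is the conjugacy class $\tau(x)$ of $G_x$ in $G$. The action is proper near $x$ if there is a neighborhood $U$ of $x$ such that $\{g\in G:U\cap gU\neq\emptyset\}$ has compact closure. The action is typical at $x$ if it is proper near $x$ and $\tau$ is constant near $x$. Subdifferentials, at a point $\overline{x}$ where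 $f$ is finite: the regular subdifferential is $\widehat\partial f(\overline{x})=\{v: f(x)\ge f(\overline{x})+\langle v,x-\overline{x}\rangle+o(|x-\overline{x}|)\text{ near }\overline{x}\}$; the subdifferential $\partial f(\overline{x})$ is the set of $v$ for which there are $x_k$ and $v_k\in\widehat\partial f(x_k)$ with $(x_k,f(x_k),v_k)\to(\overline{x},f(\overline{x}),v)$; the horizon subdifferential $\partial^\infty f(\overline{x})$ is the set of $v$ for which there are $x_k$, $v_k\in\widehat\partial f(x_k)$ and $\tau_k\searrow0$ with $(x_k,f(x_k),\tau_kv_k)\to(\overline{x},f(\overline{x}),v)$, with the convention that $0\in\partial^\infty f(\overline{x})$ always. *)

theory Defs
  imports "HOL-Analysis.Analysis" "HOL-Algebra.Group_Action" "HOL-Library.Landau_Symbols"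
begin

section \<open>Maps of class $C^k$, manifolds and Lie groups\<close>

text \<open>
  For an open set \<open>S\<close> of a finite-dimensional space, \<open>C_nat n S f\<close> says that \<open>f\<close> is \<open>n\<close> times
  continuously differentiable on \<open>S\<close>: \<open>f\<close> is differentiable and, for each fixed direction \<open>v\<close>,
  the map \<open>x \<mapsto> Df(x) v\<close> is of class $C^{n-1}$.  Fixing the direction keeps the codomain type
  unchanged in the recursion; in finite dimensions this is the usual notion.
\<close>

primrec C_nat :: "nat \<Rightarrow> 'a::real_normed_vector set \<Rightarrow> ('a \<Rightarrow> 'b::real_normed_vector) \<Rightarrow> bool" where
  "C_nat 0 S f \<longleftrightarrow> continuous_on S f"
| "C_nat (Suc n) S f \<longleftrightarrow>
     (\<forall>x\<in>S. f differentiable (at x)) \<and> (\<forall>v. C_nat n S (\<lambda>x. frechet_derivative f (at x) v))"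

definition C_enat :: "enat \<Rightarrow> 'a::real_normed_vector set \<Rightarrow> ('a \<Rightarrow> 'b::real_normed_vector) \<Rightarrow> bool" where
  "C_enat k S f \<longleftrightarrow> (\<forall>n. enat n \<le> k \<longrightarrow> C_nat n S f)"

text \<open>A chart is a pair of its domain and a coordinate map, which is relevant only on the domain.\<close>

type_synonym ('p, 'd) chart = "'p set \<times> ('p \<Rightarrow> 'd)"

definition is_chart :: "'p topology \<Rightarrow> 'p set \<Rightarrow> ('p \<Rightarrow> 'd::real_normed_vector) \<Rightarrow> bool" where
  "is_chart T U \<phi> \<longleftrightarrow>
     openin T U \<and> open (\<phi> ` U) \<and> homeomorphic_map (subtopology T U) (top_of_set (\<phi> ` U)) \<phi>"

text \<open>
  The model space is any finite-dimensional normed space \<open>'d\<close>.  The class \<open>euclidean_space\<close> is not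
  used because its instances have dimension at least one, which would exclude discrete groups.
\<close>

locale Ck_manifold =
  fixes k :: enat and T :: "'p topology" and A :: "('p, 'd::real_normed_vector) chart set"
  assumes finite_dimensional: "\<exists>B::'d set. finite B \<and> span B = UNIV"
    and Hausdorff: "Hausdorff_space T"
    and second_countable: "second_countable T"
    and charts: "\<And>U \<phi>. (U, \<phi>) \<in> A \<Longrightarrow> is_chart T U \<phi>"
    and cover: "(\<Union>(U, \<phi>)\<in>A. U) = topspace T"
    and transition: "\<And>U \<phi> V \<psi>. (U, \<phi>) \<in> A \<Longrightarrow> (V, \<psi>) \<in> A \<Longrightarrow>
      C_enat k (\<phi> ` (U \<inter> V)) (\<psi> \<circ> inv_into U \<phi>)"

definition Ck_map ::
  "enat \<Rightarrow> 'p topology \<Rightarrow> ('p, 'd::real_normed_vector) chart set \<Rightarrow>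
   'q topology \<Rightarrow> ('q, 'e::real_normed_vector) chart set \<Rightarrow> ('p \<Rightarrow> 'q) \<Rightarrow> bool" where
  "Ck_map k T A T' A' F \<longleftrightarrow>
     continuous_map T T' F \<and>
     (\<forall>(U, \<phi>)\<in>A. \<forall>(V, \<psi>)\<in>A'. C_enat k (\<phi> ` (U \<inter> F -` V)) (\<psi> \<circ> F \<circ> inv_into U \<phi>))"

definition prod_atlas ::
  "('p, 'd) chart set \<Rightarrow> ('q, 'e) chart set \<Rightarrow> ('p \<times> 'q, 'd \<times> 'e) chart set" where
  "prod_atlas A B = {(U \<times> V, map_prod \<phi> \<psi>) | U \<phi> V \<psi>. (U, \<phi>) \<in> A \<and> (V, \<psi>) \<in> B}"

definition std_atlas :: "('a, 'a) chart set" where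
  "std_atlas = {(UNIV, id)}"

locale lie_group = group G + Ck_manifold k T A
  for k :: enat and G :: "('g, 'm) monoid_scheme" (structure)
    and T :: "'g topology" and A :: "('g, 'd::real_normed_vector) chart set" +
  assumes topspace_eq: "topspace T = carrier G"
    and Ck_mult: "Ck_map k (prod_topology T T) (prod_atlas A A) T A (\<lambda>(g, h). g \<otimes> h)"
    and Ck_inv: "Ck_map k T A T A (\<lambda>g. inv g)"

section \<open>Smooth actions on Euclidean space\<close>

definition smooth_action ::
  "enat \<Rightarrow> ('g, 'm) monoid_scheme \<Rightarrow> 'g topology \<Rightarrow> ('g, 'd::real_normed_vector) chart set \<Rightarrow>
   ('g \<Rightarrow> real^'n \<Rightarrow> real^'n) \<Rightarrow> bool" where
  "smooth_action k G T A \<theta> \<longleftrightarrow>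
     group_action G UNIV \<theta> \<and>
     Ck_map k (prod_topology T euclidean) (prod_atlas A std_atlas) euclidean std_atlas
       (\<lambda>(g, x). \<theta> g x)"

text \<open>
  The image of the differential at \<open>p\<close> of a map \<open>F\<close> into a vector space, read in a chart around \<open>p\<close>.
  By the chain rule all charts around \<open>p\<close> contribute the same subspace to the union.
\<close>

definition differential_image ::
  "('p, 'd::real_normed_vector) chart set \<Rightarrow> ('p \<Rightarrow> 'b::real_normed_vector) \<Rightarrow> 'p \<Rightarrow> 'b set" where
  "differential_image A F p =
     (\<Union>(U, \<phi>)\<in>{(U, \<phi>)\<in>A. p \<in> U}. range (frechet_derivative (F \<circ> inv_into U \<phi>) (at (\<phi> p))))"

definition orbit_tangent_space ::
  "('g, 'm) monoid_scheme \<Rightarrow> ('g, 'd::real_normed_vector) chart set \<Rightarrow>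
   ('g \<Rightarrow> real^'n \<Rightarrow> real^'n) \<Rightarrow> real^'n \<Rightarrow> (real^'n) set" where
  "orbit_tangent_space G A \<theta> x = differential_image A (\<lambda>g. \<theta> g x) \<one>\<^bsub>G\<^esub>"

definition conjugacy_class :: "('g, 'm) monoid_scheme \<Rightarrow> 'g set \<Rightarrow> 'g set set" where
  "conjugacy_class G H = {g <#\<^bsub>G\<^esub> H #>\<^bsub>G\<^esub> (inv\<^bsub>G\<^esub> g) | g. g \<in> carrier G}"

definition orbit_type ::
  "('g, 'm) monoid_scheme \<Rightarrow> ('g \<Rightarrow> real^'n \<Rightarrow> real^'n) \<Rightarrow> real^'n \<Rightarrow> 'g set set" where
  "orbit_type G \<theta> x = conjugacy_class G (stabilizer G \<theta> x)"

definition proper_near ::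
  "('g, 'm) monoid_scheme \<Rightarrow> 'g topology \<Rightarrow> ('g \<Rightarrow> real^'n \<Rightarrow> real^'n) \<Rightarrow> real^'n \<Rightarrow> bool" where
  "proper_near G T \<theta> x \<longleftrightarrow>
     (\<exists>U. open U \<and> x \<in> U \<and> compactin T (T closure_of {g \<in> carrier G. U \<inter> \<theta> g ` U \<noteq> {}}))"

definition typical_at ::
  "('g, 'm) monoid_scheme \<Rightarrow> 'g topology \<Rightarrow> ('g \<Rightarrow> real^'n \<Rightarrow> real^'n) \<Rightarrow> real^'n \<Rightarrow> bool" where
  "typical_at G T \<theta> x \<longleftrightarrow>
     proper_near G T \<theta> x \<and>
     (\<exists>U. open U \<and> x \<in> U \<and> (\<forall>y\<in>U. orbit_type G \<theta> y = orbit_type G \<theta> x))"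

section \<open>Subdifferentials\<close>

definition effective_domain :: "('a \<Rightarrow> ereal) \<Rightarrow> 'a set" where
  "effective_domain f = {x. f x < \<infinity>}"

definition regular_subdifferential :: "(real^'n \<Rightarrow> ereal) \<Rightarrow> real^'n \<Rightarrow> (real^'n) set" where
  "regular_subdifferential f x =
     {v. \<bar>f x\<bar> \<noteq> \<infinity> \<and>
         (\<exists>r::real^'n \<Rightarrow> real. r \<in> o[nhds x](\<lambda>y. norm (y - x)) \<and>
            (\<forall>\<^sub>F y in nhds x. f y \<ge> f x + ereal (v \<bullet> (y - x)) + ereal (r y)))}"

definition subdifferential :: "(real^'n \<Rightarrow> ereal) \<Rightarrow> real^'n \<Rightarrow> (real^'n) set" where
  "subdifferential f x =
     {v. \<bar>f x\<bar> \<noteq> \<infinity> \<and>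
         (\<exists>xs vs. (\<forall>i::nat. vs i \<in> regular_subdifferential f (xs i)) \<and>
            xs \<longlonglongrightarrow> x \<and> (\<lambda>i. f (xs i)) \<longlonglongrightarrow> f x \<and> vs \<longlonglongrightarrow> v)}"

definition horizon_subdifferential :: "(real^'n \<Rightarrow> ereal) \<Rightarrow> real^'n \<Rightarrow> (real^'n) set" where
  "horizon_subdifferential f x =
     insert 0 {v. \<bar>f x\<bar> \<noteq> \<infinity> \<and>
         (\<exists>xs vs (ts :: nat \<Rightarrow> real).
            (\<forall>i. vs i \<in> regular_subdifferential f (xs i)) \<and>
            (\<forall>i. ts i > 0) \<and> ts \<longlonglongrightarrow> 0 \<and>
            xs \<longlonglongrightarrow> x \<and> (\<lambda>i. f (xs i)) \<longlonglongrightarrow> f x \<and> (\<lambda>i. ts i *\<^sub>R vs i) \<longlonglongrightarrow> v)}"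

definition orth_proj :: "'a::real_inner set \<Rightarrow> 'a \<Rightarrow> 'a" where
  "orth_proj V s = (THE p. p \<in> V \<and> (\<forall>w\<in>V. orthogonal (s - p) w))"

end

theory Submission
  imports Defs
begin

text \<open>
  The reason is that tangent spaces of orbits can only grow under small perturbations of the base
  point. A vector \<open>u\<close> of the tangent space at \<open>xbar\<close> is the velocity with which a fixed direction
  \<open>w\<close> of a chart around the unit of the group moves \<open>xbar\<close>. The same \<open>w\<close> moves a nearby point
  \<open>y\<close> with a velocity \<open>u(y)\<close>, which depends continuously on \<open>y\<close> because the action is of class
  $C^1$ in both variables together (\<open>action_velocity\<close>).

  An invariant function is constant along the curve through \<open>y\<close> that \<open>w\<close> generates, so every regular
  subgradient at \<open>y\<close> is orthogonal to \<open>u(y)\<close> (\<open>regular_subgradient_orthogonal_curve\<close>). This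
  orthogonality is unchanged when the subgradients are rescaled, and it survives the limits
  \<open>y \<rightarrow> xbar\<close> that define the subgradients and the horizon subgradients at \<open>xbar\<close>. Hence all of them
  are orthogonal to the tangent space, and project to zero.
\<close>

lemma smallo_norm_has_derivative_0:
  fixes r :: "'a::real_normed_vector \<Rightarrow> real"
  assumes "r \<in> o[nhds x](\<lambda>y. norm (y - x))"
  shows "r x = 0" and "(r has_derivative (\<lambda>_. 0)) (at x)"
proof -
  have bound: "\<forall>\<^sub>F y in nhds x. norm (r y) \<le> c * norm (y - x)" if "c > 0" for c
    using landau_o.smallD[OF assms that] by simp
  show r0: "r x = 0"
    using eventually_nhds_x_imp_x[OF bound[of 1]] by simp
  show "(r has_derivative (\<lambda>_. 0)) (at x)"
    unfolding has_derivative_at_alt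
  proof (intro conjI allI impI)
    fix e :: real
    assume "e > 0"
    then obtain d where "d > 0" "\<And>y. dist y x < d \<Longrightarrow> norm (r y) \<le> e * norm (y - x)"
      using bound unfolding eventually_nhds_metric by blast
    then show "\<exists>d>0. \<forall>y. norm (y - x) < d \<longrightarrow> norm (r y - r x - 0) \<le> e * norm (y - x)"
      using r0 by (auto simp: dist_norm)
  qed simp
qed

text \<open>
  Along the curve the subgradient inequality says that \<open>v \<bullet> (c t - c 0) + r (c t) \<le> 0\<close>, with equality
  at \<open>t = 0\<close>. The left-hand side thus has a local maximum there, and its derivative is \<open>v \<bullet> u\<close>.
\<close>

lemma regular_subgradient_orthogonal_curve:
  fixes f :: "real^'n \<Rightarrow> ereal"
  assumes v: "v \<in> regular_subdifferential f (c 0)"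
    and c: "(c has_vector_derivative u) (at 0)"
    and const: "\<forall>\<^sub>F t in nhds 0. f (c t) = f (c 0)"
  shows "v \<bullet> u = 0"
proof -
  from v obtain r :: "real^'n \<Rightarrow> real" where fin: "\<bar>f (c 0)\<bar> \<noteq> \<infinity>"
    and r: "r \<in> o[nhds (c 0)](\<lambda>y. norm (y - c 0))"
    and ineq: "\<forall>\<^sub>F y in nhds (c 0). f y \<ge> f (c 0) + ereal (v \<bullet> (y - c 0)) + ereal (r y)"
    by (auto simp: regular_subdifferential_def)
  define h where "h t = v \<bullet> (c t - c 0) + r (c t)" for t
  have c': "(c has_derivative (\<lambda>t. t *\<^sub>R u)) (at 0)"
    using c by (simp add: has_vector_derivative_def)
  have "((\<lambda>t. r (c t)) has_derivative (\<lambda>_. 0)) (at 0)"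
    using has_derivative_compose[OF c' smallo_norm_has_derivative_0(2)[OF r]] .
  then have "(h has_derivative (\<lambda>t. v \<bullet> (t *\<^sub>R u) + 0)) (at 0)"
    unfolding h_def by (auto intro!: derivative_eq_intros c')
  then have deriv: "(h has_field_derivative (v \<bullet> u)) (at 0)"
    by (simp add: has_field_derivative_def mult.commute[of _ "v \<bullet> u"])
  have "(c \<longlongrightarrow> c 0) (nhds 0)"
    using has_derivative_continuous[OF c'] by (simp add: continuous_at tendsto_at_iff_tendsto_nhds)
  with ineq have "\<forall>\<^sub>F t in nhds 0. f (c t) \<ge> f (c 0) + ereal (v \<bullet> (c t - c 0)) + ereal (r (c t))"
    by (rule eventually_compose_filterlim)
  with const have "\<forall>\<^sub>F t in nhds 0. h t \<le> h 0"
  proof eventually_elim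
    case (elim t)
    with fin have "h t \<le> 0"
      unfolding h_def by (cases "f (c 0)") auto
    then show ?case
      using smallo_norm_has_derivative_0(1)[OF r] by (simp add: h_def)
  qed
  then obtain d where "d > 0" "\<And>t. \<bar>0 - t\<bar> < d \<Longrightarrow> h t \<le> h 0"
    unfolding eventually_nhds_metric by (auto simp: dist_real_def)
  then show ?thesis
    using DERIV_local_max[OF deriv] by blast
qed

lemma is_chartD:
  assumes "is_chart T U \<phi>"
  shows "open (\<phi> ` U)" and "inj_on \<phi> U" and "U \<subseteq> topspace T"
proof -
  show sub: "U \<subseteq> topspace T"
    using assms by (auto simp: is_chart_def dest: openin_subset)
  have "homeomorphic_map (subtopology T U) (top_of_set (\<phi> ` U)) \<phi>"
    using assms by (simp add: is_chart_def)
  from homeomorphic_imp_injective_map[OF this] show "inj_on \<phi> U"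
    using sub by (simp add: Int_absorb1)
qed (use assms in \<open>simp add: is_chart_def\<close>)

text \<open>
  In the chart, \<open>D w\<close> is the velocity field on the whole space that the direction \<open>w\<close> generates. The
  partial derivative of the action in the group variable is the restriction of its total derivative
  to the vectors \<open>(w, 0)\<close>, which gives the continuity in the base point.
\<close>

lemma action_velocity:
  fixes \<theta> :: "'g \<Rightarrow> real^'n \<Rightarrow> real^'n"
    and A :: "('g, 'd::real_normed_vector) chart set"
  assumes k: "1 \<le> k" and act: "smooth_action k G T A \<theta>"
    and chart: "(U, \<phi>) \<in> A" "is_chart T U \<phi>" and p: "p \<in> U"
  obtains D where
    "\<And>x. (((\<lambda>g. \<theta> g x) \<circ> inv_into U \<phi>) has_derivative (\<lambda>w. D w x)) (at (\<phi> p))"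
    and "\<And>w. continuous_on UNIV (D w)"
proof -
  let ?S = "\<phi> ` U \<times> (UNIV :: (real^'n) set)"
  define H where "H = id \<circ> (\<lambda>(g, x). \<theta> g x) \<circ> inv_into (U \<times> UNIV) (map_prod \<phi> id)"
  note opn = is_chartD(1)[OF chart(2)] and inj = is_chartD(2)[OF chart(2)]
  have H: "H (a, x) = \<theta> (inv_into U \<phi> a) x" if a: "a \<in> \<phi> ` U" for a x
  proof -
    have "inj_on (map_prod \<phi> id) (U \<times> (UNIV :: (real^'n) set))"
      using inj by (simp add: map_prod_inj_on)
    then have "inv_into (U \<times> UNIV) (map_prod \<phi> id) (a, x) = (inv_into U \<phi> a, x)"
      using a by (intro inv_into_f_eq) (auto simp: inv_into_into f_inv_into_f)
    then show ?thesis
      by (simp add: H_def)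
  qed
  have "Ck_map k (prod_topology T euclidean) (prod_atlas A std_atlas) euclidean std_atlas
      (\<lambda>(g, x). \<theta> g x)"
    using act by (simp add: smooth_action_def)
  moreover have "(U \<times> UNIV, map_prod \<phi> id) \<in> prod_atlas A (std_atlas :: (real^'n, real^'n) chart set)"
    using chart(1) by (auto simp: prod_atlas_def std_atlas_def)
  ultimately have "C_enat k (map_prod \<phi> id ` (U \<times> UNIV \<inter> (\<lambda>(g, x). \<theta> g x) -` UNIV)) H"
    unfolding Ck_map_def H_def by (fastforce simp: std_atlas_def)
  then have "C_enat k ?S H"
    by (simp add: map_prod_surj_on[OF refl, where g = id and B = UNIV])
  then have "C_nat (Suc 0) ?S H"
    using k unfolding C_enat_def by (metis One_nat_def one_enat_def)
  then have diff: "\<And>z. z \<in> ?S \<Longrightarrow> (H has_derivative frechet_derivative H (at z)) (at z)"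
    and cont: "\<And>v. continuous_on ?S (\<lambda>z. frechet_derivative H (at z) v)"
    by (auto simp: frechet_derivative_works)
  define D where "D w x = frechet_derivative H (at (\<phi> p, x)) (w, 0)" for w x
  show thesis
  proof (rule that[of D])
    fix x
    have "((\<lambda>a. H (a, x)) has_derivative (\<lambda>w. D w x)) (at (\<phi> p))"
    proof -
      have "((\<lambda>a. (a, x)) has_derivative (\<lambda>w. (w, 0))) (at (\<phi> p))"
        by (auto intro!: derivative_eq_intros)
      from has_derivative_compose[OF this diff] show ?thesis
        using p by (simp add: D_def)
    qed
    then show "(((\<lambda>g. \<theta> g x) \<circ> inv_into U \<phi>) has_derivative (\<lambda>w. D w x)) (at (\<phi> p))"
      by (rule has_derivative_transform_within_open[OF _ opn]) (use p H in auto)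
  next
    fix w
    have "continuous_on UNIV (\<lambda>x. (\<lambda>z. frechet_derivative H (at z) (w, 0)) (\<phi> p, x))"
      by (rule continuous_on_compose2[OF cont]) (use p in \<open>auto intro!: continuous_intros\<close>)
    then show "continuous_on UNIV (D w)"
      unfolding D_def by simp
  qed
qed

text \<open>
  The scaling factors \<open>ts\<close> let a single limit argument cover both the subgradients, with \<open>ts\<close>
  constantly one, and the horizon subgradients.
\<close>

lemma limit_of_scaled_regular_subgradients_orthogonal:
  fixes \<theta> :: "'g \<Rightarrow> real^'n \<Rightarrow> real^'n" and f :: "real^'n \<Rightarrow> ereal"
    and A :: "('g, 'd::real_normed_vector) chart set"
  assumes k: "1 \<le> k" and lie: "lie_group k G T A" and act: "smooth_action k G T A \<theta>"
    and inv: "\<forall>g\<in>carrier G. \<forall>x. f (\<theta> g x) = f x"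
    and u: "u \<in> orbit_tangent_space G A \<theta> x"
    and vs: "\<And>i::nat. vs i \<in> regular_subdifferential f (xs i)"
    and xs: "xs \<longlonglongrightarrow> x" and lim: "(\<lambda>i. ts i *\<^sub>R vs i) \<longlonglongrightarrow> v"
  shows "v \<bullet> u = 0"
proof -
  interpret lie_group k G T A by fact
  interpret group_action G UNIV \<theta>
    using act by (simp add: smooth_action_def)
  from u obtain U \<phi> w where chart: "(U, \<phi>) \<in> A" and one: "\<one>\<^bsub>G\<^esub> \<in> U"
    and u_eq: "u = frechet_derivative ((\<lambda>g. \<theta> g x) \<circ> inv_into U \<phi>) (at (\<phi> \<one>\<^bsub>G\<^esub>)) w"
    by (auto simp: orbit_tangent_space_def differential_image_def)
  have ch: "is_chart T U \<phi>"
    using charts[OF chart] .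
  have opn: "open (\<phi> ` U)" and inj: "inj_on \<phi> U" and sub: "U \<subseteq> carrier G"
    using is_chartD[OF ch] topspace_eq by auto
  obtain D where D:
      "\<And>y. (((\<lambda>g. \<theta> g y) \<circ> inv_into U \<phi>) has_derivative (\<lambda>w. D w y)) (at (\<phi> \<one>\<^bsub>G\<^esub>))"
    and cont: "\<And>w. continuous_on UNIV (D w)"
    using action_velocity[OF k act chart ch one] by blast
  have orth: "v' \<bullet> D w y = 0" if v': "v' \<in> regular_subdifferential f y" for v' y
  proof -
    define c where "c t = \<theta> (inv_into U \<phi> (\<phi> \<one>\<^bsub>G\<^esub> + t *\<^sub>R w)) y" for t
    have c0: "c 0 = y"
      using inj one id_eq_one[symmetric] by (simp add: c_def)
    have line: "((\<lambda>t::real. \<phi> \<one>\<^bsub>G\<^esub> + t *\<^sub>R w) has_derivative (\<lambda>t. t *\<^sub>R w)) (at 0)"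
      by (auto intro!: derivative_eq_intros)
    have "(((\<lambda>g. \<theta> g y) \<circ> inv_into U \<phi>) has_derivative (\<lambda>w. D w y))
      (at (\<phi> \<one>\<^bsub>G\<^esub> + 0 *\<^sub>R w))"
      using D by simp
    from has_derivative_compose[OF line this] have "(c has_derivative (\<lambda>t. D (t *\<^sub>R w) y)) (at 0)"
      by (simp add: c_def[abs_def])
    moreover have "D (t *\<^sub>R w) y = t *\<^sub>R D w y" for t
      using linear_scale[OF has_derivative_linear[OF D]] .
    ultimately have vel: "(c has_vector_derivative D w y) (at 0)"
      by (simp add: has_vector_derivative_def)
    have "((\<lambda>t::real. \<phi> \<one>\<^bsub>G\<^esub> + t *\<^sub>R w) \<longlongrightarrow> \<phi> \<one>\<^bsub>G\<^esub> + 0 *\<^sub>R w) (nhds 0)"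
      by (intro tendsto_intros filterlim_ident)
    then have "\<forall>\<^sub>F t in nhds 0. \<phi> \<one>\<^bsub>G\<^esub> + t *\<^sub>R w \<in> \<phi> ` U"
      by (rule topological_tendstoD[OF _ opn]) (simp add: one)
    then have const: "\<forall>\<^sub>F t in nhds 0. f (c t) = f (c 0)"
      unfolding c0
    proof eventually_elim
      case (elim t)
      have "inv_into U \<phi> (\<phi> \<one>\<^bsub>G\<^esub> + t *\<^sub>R w) \<in> carrier G"
        using subsetD[OF sub inv_into_into[OF elim]] .
      then show ?case
        unfolding c_def by (rule inv[rule_format])
    qed
    show ?thesis
      by (rule regular_subgradient_orthogonal_curve[OF _ vel const]) (simp add: c0 v')
  qed
  have "(\<lambda>i. D w (xs i)) \<longlonglongrightarrow> D w x"
    using continuous_on_tendsto_compose[OF cont xs] by simp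
  with lim have "(\<lambda>i. (ts i *\<^sub>R vs i) \<bullet> D w (xs i)) \<longlonglongrightarrow> v \<bullet> D w x"
    by (rule tendsto_inner)
  moreover have "(\<lambda>i. (ts i *\<^sub>R vs i) \<bullet> D w (xs i)) = (\<lambda>_. 0)"
    using orth[OF vs] by simp
  ultimately have "v \<bullet> D w x = 0"
    using LIMSEQ_unique[OF _ tendsto_const] by metis
  then show ?thesis
    by (simp add: u_eq frechet_derivative_at[OF D, symmetric])
qed

text \<open>
  A projection \<open>p\<close> lies in \<open>V\<close>, so it is orthogonal to \<open>v\<close> and to \<open>v - p\<close>, hence to itself. The
  argument works for every set \<open>V\<close> that contains zero, so it applies directly to the tangent space,
  which is defined as a union over charts.
\<close>

lemma orth_proj_eq_0:
  assumes "0 \<in> V" and "\<And>w. w \<in> V \<Longrightarrow> v \<bullet> w = 0"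
  shows "orth_proj V v = 0"
  unfolding orth_proj_def
proof (rule the_equality)
  fix p
  assume p: "p \<in> V \<and> (\<forall>w\<in>V. orthogonal (v - p) w)"
  then have "(v - p) \<bullet> p = 0" "v \<bullet> p = 0"
    using assms(2) by (auto simp: orthogonal_def)
  then show "p = 0"
    by (simp add: inner_diff_left)
qed (use assms in \<open>auto simp: orthogonal_def\<close>)

lemma zero_in_orbit_tangent_space:
  assumes k: "1 \<le> k" and lie: "lie_group k G T A" and act: "smooth_action k G T A \<theta>"
  shows "0 \<in> orbit_tangent_space G A \<theta> x"
proof -
  interpret lie_group k G T A by fact
  have "\<one>\<^bsub>G\<^esub> \<in> (\<Union>(U, \<phi>)\<in>A. U)"
    using cover topspace_eq by simp
  then obtain U \<phi> where U: "(U, \<phi>) \<in> A" "\<one>\<^bsub>G\<^esub> \<in> U"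
    by auto
  obtain D where
    D: "\<And>y. (((\<lambda>g. \<theta> g y) \<circ> inv_into U \<phi>) has_derivative (\<lambda>w. D w y)) (at (\<phi> \<one>\<^bsub>G\<^esub>))"
    using action_velocity[OF k act U(1) charts[OF U(1)] U(2)] by blast
  have "frechet_derivative ((\<lambda>g. \<theta> g x) \<circ> inv_into U \<phi>) (at (\<phi> \<one>\<^bsub>G\<^esub>)) 0 = 0"
    using linear_0[OF has_derivative_linear[OF D]] frechet_derivative_at[OF D] by metis
  then have "0 \<in> range (frechet_derivative ((\<lambda>g. \<theta> g x) \<circ> inv_into U \<phi>) (at (\<phi> \<one>\<^bsub>G\<^esub>)))"
    by (metis rangeI)
  then show ?thesis
    using U unfolding orbit_tangent_space_def differential_image_def by blast
qed

theorem proposition1: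
  fixes k :: enat
    and G :: "('g, 'm) monoid_scheme"
    and T :: "'g topology"
    and A :: "('g, 'd::real_normed_vector) chart set"
    and \<theta> :: "'g \<Rightarrow> real^'n \<Rightarrow> real^'n"
    and f :: "real^'n \<Rightarrow> ereal"
    and xbar :: "real^'n"
  assumes "1 \<le> k"
    and "lie_group k G T A"
    and "smooth_action k G T A \<theta>"
    and "\<And>x. f x \<noteq> -\<infinity>"
    and "\<And>g x. g \<in> carrier G \<Longrightarrow> f (\<theta> g x) = f x"
    and "xbar \<in> effective_domain f"
    and "typical_at G T \<theta> xbar"
  shows "orth_proj (orbit_tangent_space G A \<theta> xbar) ` subdifferential f xbar \<subseteq> {0} \<and>
         orth_proj (orbit_tangent_space G A \<theta> xbar) ` horizon_subdifferential f xbar = {0}"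
proof -
  let ?V = "orbit_tangent_space G A \<theta> xbar"
  have zero: "0 \<in> ?V"
    using zero_in_orbit_tangent_space[OF assms(1-3)] .
  have "\<forall>g\<in>carrier G. \<forall>x. f (\<theta> g x) = f x"
    using assms(5) by simp
  note orth = limit_of_scaled_regular_subgradients_orthogonal[OF assms(1-3) this]
  have "v \<bullet> u = 0" if v: "v \<in> subdifferential f xbar" and u: "u \<in> ?V" for v u
  proof -
    from v obtain xs vs where "\<And>i::nat. vs i \<in> regular_subdifferential f (xs i)"
        "xs \<longlonglongrightarrow> xbar" "vs \<longlonglongrightarrow> v"
      unfolding subdifferential_def by blast
    then show ?thesis
      using orth[OF u, of vs xs "\<lambda>_. 1" v] by simp
  qed
  moreover have "v \<bullet> u = 0" if v: "v \<in> horizon_subdifferential f xbar" and u: "u \<in> ?V" for v u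
  proof (cases "v = 0")
    case False
    with v obtain xs vs ts where "\<And>i::nat. vs i \<in> regular_subdifferential f (xs i)"
        "xs \<longlonglongrightarrow> xbar" "(\<lambda>i. ts i *\<^sub>R vs i) \<longlonglongrightarrow> v"
      unfolding horizon_subdifferential_def by blast
    then show ?thesis
      using orth[OF u, of vs xs ts v] by simp
  qed simp
  moreover have "0 \<in> horizon_subdifferential f xbar"
    by (simp add: horizon_subdifferential_def)
  ultimately show ?thesis
    using orth_proj_eq_0[OF zero] by (auto simp: image_iff)
qed

end
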